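(* Let $N=2\cdot 5^{2a}m^2$ be a friend of $20$, where $a,m$ are positive integers, and let $K$ be an integer with $\Omega(m)\leq K$. Then $$N< 10\cdot 6^{(2^{K-2a+3}-1)^2}.$$
   Context: For a positive integer $n$, $\sigma(n)$ denotes the sum of the positive divisors of $n$, and the abundancy index of $n$ is $I(n)=\sigma(n)/n$. A positive integer $N>20$ is called a friend of $20$ if $I(N)=I(20)=21/10$. $\Omega(n)$ denotes the total number of prime divisors of $n$, counted with multiplicity. *)

theory Defs
  imports Complex_Main "HOL-Computational_Algebra.Primes"
begin

definition sigma :: "nat \<Rightarrow> nat" where
  "sigma n = (\<Sum>d | d dvd n. d)"

definition abundancy_index :: "nat \<Rightarrow> real" where
  "abundancy_index n = real (sigma n) / real n"

definition friend_of_20 :: "nat \<Rightarrow> bool" where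
  "friend_of_20 N \<longleftrightarrow> N > 20 \<and> abundancy_index N = abundancy_index 20"

definition big_Omega :: "nat \<Rightarrow> nat" where
  "big_Omega n = size (prime_factorization n)"

lemma abundancy_index_20: "abundancy_index 20 = 21 / 10"
proof -
  have "{d::nat. d dvd 20} = {d \<in> {..20}. d dvd 20}"
    by (auto dest: dvd_imp_le)
  also have "\<dots> = {1, 2, 4, 5, 10, 20}"
    by code_simp
  finally show ?thesis
    by (simp add: abundancy_index_def sigma_def)
qed

end

theory Submission imports Defs begin

text \<open>
  Write \<open>N = 2 * M^2\<close> with \<open>M = 5^a * m\<close>. Since \<open>200\<close> already has abundancy above \<open>21/10\<close>,
  \<open>M\<close> is odd, and \<open>5 * sigma (M^2) = 7 * M^2\<close>. The argument of Heath-Brown and Nielsen for odd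
  numbers of given abundancy then yields \<open>N < 6^(4^k)\<close>, where \<open>k\<close> is the number of distinct
  primes of \<open>M\<close>. On the other hand \<open>5^(2 * a - 1)\<close> divides the product of the sums
  \<open>1 + p + \<dots> + p^(2 * e)\<close> over the primes \<open>p \<noteq> 5\<close> of \<open>M\<close>. Such a sum can be divisible by \<open>5\<close> only
  if \<open>p\<close> is \<open>1\<close> modulo \<open>5\<close>, and then its \<open>5\<close>-adic valuation is that of \<open>2 * e + 1\<close>, hence at
  most \<open>e - 1\<close>. So the powers of \<open>5\<close> are paid for by repeated prime factors of \<open>m\<close>, which gives
  \<open>k \<le> big_Omega m - 2 * a + 2\<close>.
\<close>

section \<open>Majorisation for products of terms 1 - 1/x\<close>

text \<open>In t = ln w the function ln (1 - exp (-t)) is concave with derivative 1 / (exp t - 1);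
  the right-hand side is its tangent at t = ln x.\<close>

lemma ln_one_minus_inverse_le_tangent:
  fixes x w :: real
  assumes "1 < x" "1 < w"
  shows "ln (1 - 1 / w) \<le> ln (1 - 1 / x) + (ln w - ln x) / (x - 1)"
proof -
  have e1: "ln (1 - 1 / w) = ln (w - 1) - ln w"
    using ln_div [of "w - 1" w] assms by (simp add: diff_divide_distrib)
  have e2: "ln (1 - 1 / x) = ln (x - 1) - ln x"
    using ln_div [of "x - 1" x] assms by (simp add: diff_divide_distrib)
  have "ln (w - 1) - ln (x - 1) + ln x - ln w = ln ((w - 1) * x / ((x - 1) * w))"
    using assms by (simp add: ln_mult ln_div)
  also have "\<dots> \<le> (w - 1) * x / ((x - 1) * w) - 1"
    using assms by (intro ln_le_minus_one) simp
  finally have "(x - 1) * (ln (w - 1) - ln (x - 1) + ln x - ln w)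
      \<le> (x - 1) * ((w - 1) * x / ((x - 1) * w) - 1)"
    using assms by (intro mult_left_mono) auto
  also have "\<dots> = 1 - x / w"
    using assms by (simp add: field_simps)
  also have "\<dots> \<le> - ln (x / w)"
    using ln_le_minus_one [of "x / w"] assms by simp
  also have "\<dots> = ln w - ln x"
    using assms by (simp add: ln_div)
  finally have "ln (w - 1) - ln (x - 1) + ln x - ln w \<le> (ln w - ln x) / (x - 1)"
    using assms by (simp add: pos_le_divide_eq mult.commute)
  then show ?thesis
    unfolding e1 e2 by simp
qed

text \<open>Abel summation in inductive form: lowering the weight in front of a nonnegative partial
  sum can only lower the value.\<close>

lemma weighted_sum_ge_last_weight:
  fixes c d :: "nat \<Rightarrow> real"
  assumes "\<And>i. i < n \<Longrightarrow> c (Suc i) \<le> c i"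
    and "\<And>s. s \<le> n \<Longrightarrow> 0 \<le> (\<Sum>i<s. d i)"
  shows "c n * (\<Sum>i<Suc n. d i) \<le> (\<Sum>i<Suc n. c i * d i)"
  using assms
proof (induction n)
  case 0
  then show ?case by simp
next
  case (Suc n)
  have "c (Suc n) * (\<Sum>i<Suc n. d i) \<le> c n * (\<Sum>i<Suc n. d i)"
    using Suc.prems(1) [of n] Suc.prems(2) [of "Suc n"] by (intro mult_right_mono) simp_all
  also have "\<dots> \<le> (\<Sum>i<Suc n. c i * d i)"
    using Suc by simp
  finally show ?case
    by (simp add: algebra_simps)
qed

text \<open>Weak majorisation for the increasing concave function \<open>t \<mapsto> ln (1 - exp (- t))\<close>.\<close>

lemma prod_one_minus_inverse_mono:
  fixes x y :: "nat \<Rightarrow> real"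
  assumes x: "\<And>i. i < n \<Longrightarrow> 1 < x i" and y: "\<And>i. i < n \<Longrightarrow> 1 < y i"
    and sorted: "\<And>i. Suc i < n \<Longrightarrow> x i \<le> x (Suc i)"
    and dom: "\<And>s. s \<le> n \<Longrightarrow> (\<Prod>i<s. y i) \<le> (\<Prod>i<s. x i)"
  shows "(\<Prod>i<n. 1 - 1 / y i) \<le> (\<Prod>i<n. 1 - 1 / x i)"
proof (cases n)
  case 0
  then show ?thesis by simp
next
  case (Suc k)
  have x': "0 < 1 - 1 / x i" and y': "0 < 1 - 1 / y i" if "i < n" for i
    using x [OF that] y [OF that] by simp_all
  \<comment> \<open>\<open>c i\<close> is the tangent slope at ln (x i), which decreases along the
    sorted \<open>x\<close>; \<open>dom\<close> makes the partial sums of \<open>d\<close>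
    nonnegative.\<close>
  define c where "c i = 1 / (x i - 1)" for i
  define d where "d i = ln (x i) - ln (y i)" for i
  have partial: "0 \<le> (\<Sum>i<s. d i)" if "s \<le> n" for s
  proof -
    have pos: "0 < x i" "0 < y i" if "i < s" for i
      using x [of i] y [of i] that \<open>s \<le> n\<close> by auto
    have "ln (\<Prod>i<s. y i) \<le> ln (\<Prod>i<s. x i)"
      using dom [OF that] pos by (intro ln_mono prod_pos) auto
    moreover have "ln (\<Prod>i<s. y i) = (\<Sum>i<s. ln (y i))"
      by (intro ln_prod finite_lessThan) (metis lessThan_iff less_irrefl pos(2))
    moreover have "ln (\<Prod>i<s. x i) = (\<Sum>i<s. ln (x i))"
      by (intro ln_prod finite_lessThan) (metis lessThan_iff less_irrefl pos(1))
    ultimately show ?thesis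
      by (simp add: d_def sum_subtractf)
  qed
  have "0 \<le> c k * (\<Sum>i<Suc k. d i)"
    using partial [of "Suc k"] x [of k] Suc by (simp add: c_def)
  also have "\<dots> \<le> (\<Sum>i<Suc k. c i * d i)"
  proof (rule weighted_sum_ge_last_weight)
    show "c (Suc i) \<le> c i" if "i < k" for i
      using sorted [of i] x [of i] that Suc by (simp add: c_def frac_le)
    show "0 \<le> (\<Sum>i<s. d i)" if "s \<le> k" for s
      using partial that Suc by simp
  qed
  also have "\<dots> \<le> (\<Sum>i<Suc k. ln (1 - 1 / x i) - ln (1 - 1 / y i))"
  proof (rule sum_mono)
    fix i assume "i \<in> {..<Suc k}"
    then show "c i * d i \<le> ln (1 - 1 / x i) - ln (1 - 1 / y i)"
      using ln_one_minus_inverse_le_tangent [of "x i" "y i"] x [of i] y [of i] Suc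
      by (simp add: c_def d_def diff_divide_distrib)
  qed
  finally have "(\<Sum>i<n. ln (1 - 1 / y i)) \<le> (\<Sum>i<n. ln (1 - 1 / x i))"
    using Suc by (simp add: sum_subtractf)
  moreover have "ln (\<Prod>i<n. 1 - 1 / y i) = (\<Sum>i<n. ln (1 - 1 / y i))"
    using y' by (intro ln_prod) force+
  moreover have "ln (\<Prod>i<n. 1 - 1 / x i) = (\<Sum>i<n. ln (1 - 1 / x i))"
    using x' by (intro ln_prod) force+
  moreover have "0 < (\<Prod>i<n. 1 - 1 / y i)" "0 < (\<Prod>i<n. 1 - 1 / x i)"
    using x' y' by (auto intro!: prod_pos)
  ultimately show ?thesis
    by (metis ln_le_cancel_iff)
qed

section \<open>Sylvester-type products\<close>

lemma prod_power_two_power_plus_one: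
  fixes c :: "'a :: comm_ring_1"
  shows "(c - 1) * (\<Prod>i<n. c ^ (2 ^ i) + 1) = c ^ (2 ^ n) - 1"
proof (induction n)
  case 0
  then show ?case by simp
next
  case (Suc n)
  have "(c - 1) * (\<Prod>i<Suc n. c ^ (2 ^ i) + 1)
      = ((c - 1) * (\<Prod>i<n. c ^ (2 ^ i) + 1)) * (c ^ (2 ^ n) + 1)"
    by (simp add: mult_ac)
  also have "\<dots> = c ^ (2 ^ Suc n) - 1"
    unfolding Suc by (simp add: mult_2 power_add algebra_simps)
  finally show ?case .
qed

text \<open>Each factor is c^(2^i) / (c^(2^i) + 1), so the product telescopes to (c - 1) / c times
  c^(2^n) / (c^(2^n) - 1), and the last quotient exceeds 1.\<close>

lemma prod_one_minus_inverse_power_two_power_gt: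
  fixes c :: real
  assumes "1 < c"
  shows "(c - 1) / c < (\<Prod>i<n. 1 - 1 / (c ^ (2 ^ i) + 1))"
proof -
  have pos: "c ^ k + 1 > 0" for k :: nat
    using assms by (intro add_pos_pos) auto
  have eq: "(\<Prod>i<n. 1 - 1 / (c ^ (2 ^ i) + 1)) * (c ^ (2 ^ n) - 1) * c = (c - 1) * c ^ (2 ^ n)"
  proof (induction n)
    case 0
    then show ?case by simp
  next
    case (Suc n)
    have "c ^ (2 ^ Suc n) = c ^ (2 ^ n) * c ^ (2 ^ n)"
      by (simp add: mult_2 power_add)
    then have "(1 - 1 / (c ^ (2 ^ n) + 1)) * (c ^ (2 ^ Suc n) - 1) = c ^ (2 ^ n) * (c ^ (2 ^ n) - 1)"
      using pos [of "2 ^ n"] by (simp add: field_simps)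
    then have "(\<Prod>i<Suc n. 1 - 1 / (c ^ (2 ^ i) + 1)) * (c ^ (2 ^ Suc n) - 1) * c
        = c ^ (2 ^ n) * ((\<Prod>i<n. 1 - 1 / (c ^ (2 ^ i) + 1)) * (c ^ (2 ^ n) - 1) * c)"
      by (simp add: mult_ac)
    also have "\<dots> = (c - 1) * c ^ (2 ^ Suc n)"
      unfolding Suc by (simp add: mult_2 power_add mult_ac)
    finally show ?case .
  qed
  have gt: "c ^ (2 ^ n) > 1"
    using assms by (simp add: one_less_power)
  have "(c - 1) * (c ^ (2 ^ n) - 1) < (c - 1) * c ^ (2 ^ n)"
    using assms by (intro mult_strict_left_mono) auto
  also have "\<dots> = ((\<Prod>i<n. 1 - 1 / (c ^ (2 ^ i) + 1)) * c) * (c ^ (2 ^ n) - 1)"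
    using eq by (simp add: mult_ac)
  finally have "c - 1 < (\<Prod>i<n. 1 - 1 / (c ^ (2 ^ i) + 1)) * c"
    using gt by (simp add: mult_less_cancel_right)
  then show ?thesis
    using assms by (simp add: pos_divide_less_eq)
qed

text \<open>If every initial segment of the sorted values had a large product, the values would dominate
  the Sylvester-type sequence \<open>(a + 1) ^ (2 ^ i) + 1\<close>, whose partial products of \<open>1 - 1 / y\<close>
  all stay above \<open>a / (a + 1)\<close>.\<close>

lemma exists_subset_small_prod:
  fixes f :: "'a \<Rightarrow> nat" and a :: nat
  assumes "finite X" and "0 < a" and f: "\<And>x. x \<in> X \<Longrightarrow> 1 < f x"
    and le: "(\<Prod>x\<in>X. 1 - 1 / real (f x)) \<le> real a / (real a + 1)"
  obtains T where "T \<subseteq> X" "T \<noteq> {}" "a * (\<Prod>x\<in>T. f x) < (a + 1) ^ (2 ^ card T)"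
proof (rule ccontr)
  assume "\<not> thesis"
  with that have big: "(a + 1) ^ (2 ^ card T) \<le> a * (\<Prod>x\<in>T. f x)" if "T \<subseteq> X" "T \<noteq> {}" for T
    using that by (meson not_le)
  obtain xs where xs: "set xs = X" "distinct xs"
    using finite_distinct_list [OF \<open>finite X\<close>] by blast
  define ys where "ys = sort_key f xs"
  have ys: "set ys = X" "distinct ys" "sorted (map f ys)"
    using xs by (simp_all add: ys_def)
  define n where "n = length ys"
  define c where "c = real a + 1"
  have inj: "inj_on ((!) ys) {..<s}" if "s \<le> n" for s
    using ys(2) that by (intro inj_on_nth) (auto simp: n_def)
  have mem: "ys ! i \<in> X" if "i < n" for i
    using that ys(1) by (auto simp: n_def)
  have "(\<Prod>i<n. 1 - 1 / (c ^ (2 ^ i) + 1)) \<le> (\<Prod>i<n. 1 - 1 / real (f (ys ! i)))"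
  proof (rule prod_one_minus_inverse_mono)
    show "1 < real (f (ys ! i))" if "i < n" for i
      using f [OF mem [OF that]] by simp
    show "1 < c ^ (2 ^ i) + 1" for i
      by (simp add: c_def)
    show "real (f (ys ! i)) \<le> real (f (ys ! Suc i))" if "Suc i < n" for i
      using sorted_nth_mono [OF ys(3), of i "Suc i"] that by (simp add: n_def)
    show "(\<Prod>i<s. c ^ (2 ^ i) + 1) \<le> (\<Prod>i<s. real (f (ys ! i)))" if "s \<le> n" for s
    proof (cases "s = 0")
      case False
      let ?T = "(!) ys ` {..<s}"
      have "(a + 1) ^ (2 ^ card ?T) \<le> a * (\<Prod>x\<in>?T. f x)"
        using mem that False by (intro big) auto
      then have "(a + 1) ^ (2 ^ s) \<le> a * (\<Prod>i<s. f (ys ! i))"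
        using inj [OF that] by (simp add: card_image prod.reindex)
      then have "real ((a + 1) ^ (2 ^ s)) \<le> real (a * (\<Prod>i<s. f (ys ! i)))"
        by (simp only: of_nat_le_iff)
      then have "c ^ (2 ^ s) \<le> real a * (\<Prod>i<s. real (f (ys ! i)))"
        by (simp add: c_def add.commute)
      moreover have "real a * (\<Prod>i<s. c ^ (2 ^ i) + 1) = c ^ (2 ^ s) - 1"
        using prod_power_two_power_plus_one [of c s] by (simp add: c_def)
      ultimately have "real a * (\<Prod>i<s. c ^ (2 ^ i) + 1) \<le> real a * (\<Prod>i<s. real (f (ys ! i)))"
        by linarith
      then show ?thesis
        using \<open>0 < a\<close> by simp
    qed simp
  qed
  also have "\<dots> = (\<Prod>x\<in>X. 1 - 1 / real (f x))"
  proof -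
    have "X = (!) ys ` {..<n}"
      using ys(1) by (auto simp: n_def in_set_conv_nth)
    then show ?thesis
      using inj [of n] by (simp add: prod.reindex)
  qed
  also have "\<dots> \<le> (c - 1) / c"
    using le by (simp add: c_def)
  finally show False
    using prod_one_minus_inverse_power_two_power_gt [of c n] \<open>0 < a\<close> by (simp add: c_def)
qed

section \<open>The Heath-Brown and Nielsen induction\<close>

text \<open>One round of the induction: for integers, u + 1 is still at most D^(2^k), so selecting t
  indices multiplies the exponent by 2^t.\<close>

lemma less_power_two_power_trans:
  fixes u v D :: nat
  assumes "v < (u + 1) ^ (2 ^ t)" "u < D ^ (2 ^ k)"
  shows "v < D ^ (2 ^ (k + t))"
proof -
  have "(u + 1) ^ (2 ^ t) \<le> (D ^ (2 ^ k)) ^ (2 ^ t)"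
    using assms(2) by (intro power_mono) auto
  with assms(1) show ?thesis
    unfolding power_add power_mult by (rule less_le_trans)
qed

text \<open>The induction runs over states \<open>(S, P)\<close>: for \<open>p \<in> S\<close> the whole component \<open>p ^ e p\<close> has
  been bounded, for \<open>p \<in> P\<close> only \<open>p\<close> itself. Every index enters \<open>P\<close> once and later moves to
  \<open>S\<close> once, each time doubling the exponent of the bound on \<open>min (a S P) (b S P)\<close>. If
  \<open>b < a\<close>, the product over \<open>P\<close> must account for the difference and some of \<open>P\<close> moves to \<open>S\<close>; if
  \<open>a < b\<close>, the unknown part must, and \<open>P\<close> grows; \<open>a = b\<close> contradicts parity unless \<open>S = F\<close>.\<close>

theorem heath_brown_nielsen_bound:
  fixes F :: "nat set" and e :: "nat \<Rightarrow> nat" and d n :: nat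
  assumes "finite F" and F: "\<And>p. p \<in> F \<Longrightarrow> 1 < p \<and> odd p \<and> 0 < e p \<and> even (e p)"
    and "odd d" and "d < n"
    and eq: "d * (\<Prod>p\<in>F. \<Sum>i\<le>e p. p ^ i) = n * (\<Prod>p\<in>F. p ^ e p)"
  shows "n * (\<Prod>p\<in>F. p ^ e p) < (d + 1) ^ (4 ^ card F)"
proof -
  define s where "s p = (\<Sum>i\<le>e p. p ^ i)" for p
  define x where "x p = p ^ (e p + 1)" for p
  \<comment> \<open>On \<open>S\<close> these carry the exact numerator and denominator of
    \<open>rho p\<close>; on \<open>P\<close> they carry those of p / (p - 1), from which
    \<open>rho p\<close> differs by the factor \<open>theta p\<close>.\<close>
  define a where "a S P = d * (\<Prod>p\<in>S. s p) * (\<Prod>p\<in>P. p)" for S P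
  define b where "b S P = n * (\<Prod>p\<in>S. p ^ e p) * (\<Prod>p\<in>P. p - 1)" for S P
  define rho where "rho p = real (s p) / real (p ^ e p)" for p
  define theta where "theta p = 1 - 1 / real (x p)" for p
  have "d > 0" "n > 0"
    using \<open>odd d\<close> \<open>d < n\<close> by (auto elim: oddE)
  have s_pos: "s p > 0" for p
    unfolding s_def by (rule sum_pos2 [of _ 0]) auto
  have odd_s: "odd (s p)" if "p \<in> F" for p
    using F [OF that] by (simp add: s_def even_sum_iff)
  have geom: "real (s p) * (real p - 1) = real (x p) - 1" for p
    using one_diff_power_eq [of "real p" "e p + 1"]
    by (simp add: s_def x_def lessThan_Suc_atMost algebra_simps)
  have x_gt: "1 < x p" if "p \<in> F" for p
    unfolding x_def using F [OF that] by (intro one_less_power) auto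
  have rho_theta: "rho p * (real p - 1) = real p * theta p" if "p \<in> F" for p
  proof -
    have "real (p ^ e p) > 0" "real p > 0"
      using F [OF that] by auto
    then have "rho p * (real p - 1) = (real (x p) - 1) / real (p ^ e p)"
      using geom [of p] by (simp add: rho_def)
    also have "\<dots> = real p * theta p"
      using \<open>real p > 0\<close> by (simp add: theta_def x_def field_simps)
    finally show ?thesis .
  qed
  have rho_gt: "1 < rho p" if "p \<in> F" for p
  proof -
    have "p ^ e p < p ^ e p + p ^ 0"
      by simp
    also have "\<dots> = (\<Sum>i\<in>{0, e p}. p ^ i)"
      using F [OF that] by simp
    also have "\<dots> \<le> s p"
      unfolding s_def by (intro sum_mono2) auto
    finally have "real (p ^ e p) < real (s p)"
      by (simp only: of_nat_less_iff)
    moreover have "0 < real (p ^ e p)"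
      using F [OF that] by simp
    ultimately show ?thesis
      unfolding rho_def by (simp only: less_divide_eq_1_pos)
  qed
  have theta: "0 < theta p" "theta p \<le> 1" if "p \<in> F" for p
    using x_gt [OF that] by (auto simp: theta_def)
  have rho_le: "(1 - 1 / real p) * rho p \<le> 1" if "p \<in> F" for p
    using rho_theta [OF that] theta [OF that] F [OF that] by (auto simp: field_simps)
  \<comment> \<open>By \<open>eq\<close>, d times the product of all \<open>rho p\<close> is n.
    Clearing denominators on \<open>S\<close> and \<open>P\<close> leaves \<open>theta\<close> on
    \<open>P\<close> and \<open>rho\<close> on the undecided rest.\<close>
  have state: "real (a S P) * ((\<Prod>p\<in>P. theta p) * (\<Prod>p\<in>F - S - P. rho p)) = real (b S P)"
    if "S \<subseteq> F" "P \<subseteq> F" "S \<inter> P = {}" for S P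
  proof -
    let ?R = "F - S - P"
    have fin: "finite S" "finite P" "finite ?R"
      using that \<open>finite F\<close> by (auto intro: finite_subset)
    have split: "prod g F = prod g S * prod g P * prod g ?R" for g :: "nat \<Rightarrow> real"
    proof -
      have "prod g F = prod g (S \<union> (P \<union> ?R))"
        using that by (intro arg_cong [of _ _ "prod g"]) auto
      also have "\<dots> = prod g S * prod g (P \<union> ?R)"
        using that fin by (intro prod.union_disjoint) auto
      also have "prod g (P \<union> ?R) = prod g P * prod g ?R"
        using that fin by (intro prod.union_disjoint) auto
      finally show ?thesis by simp
    qed
    have "real (d * (\<Prod>p\<in>F. s p)) = real (n * (\<Prod>p\<in>F. p ^ e p))"
      using eq by (simp only: s_def)
    moreover have nz: "real (p ^ e p) \<noteq> 0" if "p \<in> F" for p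
      using F [OF that] by auto
    then have "(\<Prod>p\<in>F. real (p ^ e p)) \<noteq> 0"
      using \<open>finite F\<close> by (simp only: prod_zero_iff) blast
    moreover have "prod rho F = (\<Prod>p\<in>F. real (s p)) / (\<Prod>p\<in>F. real (p ^ e p))"
      by (simp add: rho_def prod_dividef)
    ultimately have *: "real d * prod rho F = real n"
      by (simp add: nonzero_divide_eq_eq)
    have S: "prod rho S * (\<Prod>p\<in>S. real (p ^ e p)) = (\<Prod>p\<in>S. real (s p))"
      unfolding prod.distrib [symmetric] rho_def
      using nz \<open>S \<subseteq> F\<close> by (intro prod.cong refl) (metis nonzero_divide_eq_eq subsetD)
    have "(\<Prod>p\<in>P. real (p - 1)) = (\<Prod>p\<in>P. real p - 1)"
      using F \<open>P \<subseteq> F\<close> by (intro prod.cong) (force simp: of_nat_diff)+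
    moreover have "prod rho P * (\<Prod>p\<in>P. real p - 1) = (\<Prod>p\<in>P. real p) * prod theta P"
      unfolding prod.distrib [symmetric] using rho_theta \<open>P \<subseteq> F\<close> by (intro prod.cong) auto
    ultimately have P: "prod rho P * (\<Prod>p\<in>P. real (p - 1)) = (\<Prod>p\<in>P. real p) * prod theta P"
      by simp
    have "real (a S P) * (prod theta P * prod rho ?R)
        = real d * (\<Prod>p\<in>S. real (s p)) * ((\<Prod>p\<in>P. real p) * prod theta P) * prod rho ?R"
      by (simp add: a_def)
    also have "\<dots> = (real d * prod rho F) * (\<Prod>p\<in>S. real (p ^ e p)) * (\<Prod>p\<in>P. real (p - 1))"
      unfolding S [symmetric] P [symmetric] split by simp
    also have "\<dots> = real (b S P)"
      unfolding * by (simp add: b_def)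
    finally show ?thesis .
  qed
  have step: "n * (\<Prod>p\<in>F. p ^ e p) < (d + 1) ^ (4 ^ card F)"
    if "S \<subseteq> F" "P \<subseteq> F" "S \<inter> P = {}"
      "min (a S P) (b S P) < (d + 1) ^ (2 ^ (2 * card S + card P))" for S P
    using that
  proof (induction "2 * card F - (2 * card S + card P)" arbitrary: S P rule: less_induct)
    case less
    note SP = less.prems(1-3)
    let ?R = "F - S - P" and ?k = "2 * card S + card P"
    have fin: "finite S" "finite P" "finite ?R"
      using SP \<open>finite F\<close> by (auto intro: finite_subset)
    have IH: ?thesis
      if "S' \<subseteq> F" "P' \<subseteq> F" "S' \<inter> P' = {}" "2 * card S' + card P' = ?k + t" "0 < t"
        "min (a S' P') (b S' P') < (d + 1) ^ (2 ^ (?k + t))" for S' P' t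
    proof (rule less.hyps)
      have "card S' + card P' = card (S' \<union> P')"
        using that \<open>finite F\<close> by (intro card_Un_disjoint [symmetric]) (auto intro: finite_subset)
      also have "\<dots> \<le> card F"
        using that \<open>finite F\<close> by (intro card_mono) auto
      finally have "2 * card S' + card P' \<le> 2 * card F"
        by simp
      then show "2 * card F - (2 * card S' + card P') < 2 * card F - ?k"
        using that by simp
    qed (use that in auto)
    have a_pos: "0 < a S P"
      using SP F \<open>d > 0\<close> s_pos by (force simp: a_def intro!: prod_pos)
    have b_pos: "0 < b S P"
      using SP F \<open>n > 0\<close> by (force simp: b_def intro!: prod_pos)
    have theta_P: "prod theta P \<le> 1" "0 \<le> prod theta P"
      using theta SP by (intro prod_le_1 prod_nonneg; force intro: less_imp_le)+
    have rho_R: "1 \<le> prod rho ?R"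
      using rho_gt by (intro prod_ge_1 less_imp_le) auto
    consider "a S P = b S P" | "b S P < a S P" | "a S P < b S P"
      by linarith
    then show ?case
    proof cases
      case 1
      \<comment> \<open>Each p - 1 is even, whereas d, p and \<open>s p\<close> are odd
        (\<open>s p\<close> has an odd number of odd terms). With \<open>P\<close> empty, the
        remaining \<open>rho p\<close>, all above 1, multiply to 1.\<close>
      have "P = {}"
      proof (rule ccontr)
        assume "P \<noteq> {}"
        then have "even (b S P)"
          using SP F fin by (fastforce simp: b_def even_prod_iff)
        moreover have "odd (a S P)"
          using SP F fin odd_s \<open>odd d\<close> by (auto simp: a_def even_prod_iff)
        ultimately show False
          using 1 by simp
      qed
      moreover from this have "prod rho ?R = 1"
        using state [OF SP] 1 a_pos by simp
      then have "?R = {}"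
        using less_1_prod [of ?R rho] rho_gt fin by force
      ultimately have "S = F"
        using SP by auto
      then show ?thesis
        using less.prems(4) 1 \<open>P = {}\<close> by (simp add: b_def power_mult)
    next
      case 2
      \<comment> \<open>Since \<open>rho\<close> only increases the product, that of
        \<open>theta\<close> is at most b/a; integrality turns b < a into the bound b / (b +
        1).\<close>
      have "prod theta P \<le> prod theta P * prod rho ?R"
        using theta_P rho_R by (simp add: mult_le_cancel_left1)
      also have "\<dots> = real (b S P) / real (a S P)"
        using state [OF SP] a_pos by (simp add: field_simps)
      also have "\<dots> \<le> real (b S P) / (real (b S P) + 1)"
        using 2 by (intro divide_left_mono) auto
      finally have "(\<Prod>p\<in>P. 1 - 1 / real (x p)) \<le> real (b S P) / (real (b S P) + 1)"
        by (simp add: theta_def)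
      then obtain T where T: "T \<subseteq> P" "T \<noteq> {}" "b S P * (\<Prod>p\<in>T. x p) < (b S P + 1) ^ (2 ^ card T)"
        using exists_subset_small_prod [OF fin(2) b_pos, of x] x_gt SP by blast
      have finT: "finite T"
        using T fin finite_subset by blast
      have cards: "card (S \<union> T) = card S + card T" "card P = card (P - T) + card T" "0 < card T"
        using T SP fin finT card_mono [of P T] card_Un_disjoint [of S T]
        by (auto simp: card_Diff_subset card_gt_0_iff)
      \<comment> \<open>Moving \<open>T\<close> from \<open>P\<close> to \<open>S\<close> exchanges
        p - 1 for p ^ e p in \<open>b\<close>; this crude inequality caps the growth by the product
        of the \<open>x p\<close>.\<close>
      have "(\<Prod>p\<in>T. p ^ e p) \<le> (\<Prod>p\<in>T. (p - 1) * x p)"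
      proof (rule prod_mono)
        fix p assume "p \<in> T"
        then have "1 < p"
          using T SP F by blast
        then have "1 * p ^ e p \<le> (p - 1) * (p * p ^ e p)"
          by (intro mult_mono) auto
        then show "0 \<le> p ^ e p \<and> p ^ e p \<le> (p - 1) * x p"
          by (simp add: x_def)
      qed
      then have "n * (\<Prod>p\<in>S. p ^ e p) * (\<Prod>p\<in>P - T. p - 1) * (\<Prod>p\<in>T. p ^ e p)
          \<le> n * (\<Prod>p\<in>S. p ^ e p) * (\<Prod>p\<in>P - T. p - 1) * (\<Prod>p\<in>T. (p - 1) * x p)"
        by (rule mult_left_mono) simp
      moreover have "(\<Prod>p\<in>S \<union> T. p ^ e p) = (\<Prod>p\<in>S. p ^ e p) * (\<Prod>p\<in>T. p ^ e p)"
        using T SP fin finT by (intro prod.union_disjoint) auto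
      moreover have "(\<Prod>p\<in>P. p - 1) = (\<Prod>p\<in>P - T. p - 1) * (\<Prod>p\<in>T. p - 1)"
        using prod.subset_diff [OF T(1) fin(2)] by simp
      ultimately have "b (S \<union> T) (P - T) \<le> b S P * (\<Prod>p\<in>T. x p)"
        by (simp add: b_def prod.distrib mult_ac)
      also note T(3)
      finally have "b (S \<union> T) (P - T) < (d + 1) ^ (2 ^ (?k + card T))"
        using less_power_two_power_trans less.prems(4) 2 by simp
      then show ?thesis
        using T SP cards by (intro IH [of "S \<union> T" "P - T" "card T"]) auto
    next
      case 3
      \<comment> \<open>As theta <= 1, the remaining \<open>rho p\<close> must lift a to at least b,
        and each is at most p / (p - 1). Hence the product of 1 - 1/p is at most a/b.\<close>
      have "(\<Prod>p\<in>?R. 1 - 1 / real p) * prod rho ?R \<le> 1"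
        unfolding prod.distrib [symmetric] using rho_le rho_gt F
        by (intro prod_le_1) (force intro!: mult_nonneg_nonneg)+
      then have "real (a S P) * ((\<Prod>p\<in>?R. 1 - 1 / real p) * prod rho ?R) \<le> real (a S P)"
        by (intro mult_left_le) auto
      moreover have "real (b S P) \<le> real (a S P) * prod rho ?R"
        unfolding state [OF SP, symmetric] using theta_P rho_R
        by (intro mult_left_mono mult_left_le_one_le) auto
      then have "(\<Prod>p\<in>?R. 1 - 1 / real p) * real (b S P)
          \<le> (\<Prod>p\<in>?R. 1 - 1 / real p) * (real (a S P) * prod rho ?R)"
        by (intro mult_left_mono prod_nonneg) (auto simp: divide_le_eq_1 Suc_le_eq)
      ultimately have "(\<Prod>p\<in>?R. 1 - 1 / real p) * real (b S P) \<le> real (a S P)"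
        by (simp add: mult_ac)
      then have "(\<Prod>p\<in>?R. 1 - 1 / real p) \<le> real (a S P) / real (b S P)"
        using b_pos by (simp add: field_simps)
      also have "\<dots> \<le> real (a S P) / (real (a S P) + 1)"
        using 3 by (intro divide_left_mono) auto
      finally obtain T where T: "T \<subseteq> ?R" "T \<noteq> {}" "a S P * \<Prod>T < (a S P + 1) ^ (2 ^ card T)"
        using exists_subset_small_prod [OF fin(3) a_pos, of "\<lambda>p. p"] F by blast
      have finT: "finite T"
        using T fin finite_subset by blast
      have cards: "card (P \<union> T) = card P + card T" "0 < card T"
        using T SP fin finT card_Un_disjoint [of P T] by (auto simp: card_gt_0_iff)
      have "\<Prod>(P \<union> T) = \<Prod>P * \<Prod>T"
        using T SP fin finT by (intro prod.union_disjoint) auto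
      then have "a S (P \<union> T) = a S P * \<Prod>T"
        by (simp add: a_def)
      also note T(3)
      finally have "a S (P \<union> T) < (d + 1) ^ (2 ^ (?k + card T))"
        using less_power_two_power_trans less.prems(4) 3 by simp
      then show ?thesis
        using T SP cards by (intro IH [of S "P \<union> T" "card T"]) auto
    qed
  qed
  show ?thesis
    by (rule step [of "{}" "{}"]) (use \<open>d < n\<close> in \<open>auto simp: a_def b_def\<close>)
qed

section \<open>The 5-adic valuation of sums of powers\<close>

lemma sum_powers_mult:
  fixes y :: "'a :: comm_semiring_1"
  shows "(\<Sum>i<k * n. y ^ i) = (\<Sum>i<k. y ^ i) * (\<Sum>j<n. (y ^ k) ^ j)"
proof -
  have "(\<Sum>i<k * n. y ^ i) = (\<Sum>j<n. \<Sum>i\<in>{j * k..<j * k + k}. y ^ i)"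
    by (simp add: sum.nat_group mult.commute)
  also have "\<dots> = (\<Sum>j<n. (\<Sum>i<k. y ^ i) * (y ^ k) ^ j)"
  proof (rule sum.cong [OF refl])
    fix j
    show "(\<Sum>i\<in>{j * k..<j * k + k}. y ^ i) = (\<Sum>i<k. y ^ i) * (y ^ k) ^ j"
      using sum.shift_bounds_nat_ivl [of "(^) y" 0 "j * k" k]
      by (simp add: lessThan_atLeast0 power_add power_mult sum_distrib_right mult.commute [of j]
          add.commute)
  qed
  finally show ?thesis
    by (simp add: sum_distrib_left)
qed

lemma sum_five_powers_mod_25:
  fixes y :: nat
  assumes "y mod 5 = 1"
  shows "(\<Sum>i<5. y ^ i) mod 25 = 5"
proof -
  obtain t where t: "y = 5 * t + 1"
    using assms by (metis mult_div_mod_eq)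
  have "(\<Sum>i<5. y ^ i) = 1 + y + y ^ 2 + y ^ 3 + y ^ 4"
    by (simp add: lessThan_nat_numeral)
  also have "\<dots> = 5 + 25 * (2 * t + 10 * t ^ 2 + 25 * t ^ 3 + 25 * t ^ 4)"
    unfolding t by (simp add: algebra_simps power2_eq_square power3_eq_cube power4_eq_xxxx)
  finally show ?thesis
    by (simp only: mod_mult_self2) simp
qed

text \<open>Lifting the exponent: n must be 5 * k, the sum of the first five powers carries exactly
  one factor 5 (it is 5 modulo 25), and the cofactor is the same kind of sum for
  \<open>y ^ 5\<close> and k.\<close>

lemma five_power_dvd_sum_powers:
  fixes y :: nat
  assumes "y mod 5 = 1" "5 ^ v dvd (\<Sum>i<n. y ^ i)"
  shows "5 ^ v dvd n"
  using assms
proof (induction v arbitrary: y n)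
  case (Suc v)
  have "y ^ i mod 5 = 1" for i
    using power_mod [of y 5 i] Suc.prems(1) by simp
  then have "(\<Sum>i<n. y ^ i) mod 5 = (\<Sum>i<n. 1) mod 5"
    by (subst mod_sum_eq [symmetric]) simp
  moreover have "5 dvd (\<Sum>i<n. y ^ i)"
    using Suc.prems(2) by (rule dvd_trans [rotated]) simp
  ultimately have "5 dvd n"
    by (simp add: dvd_eq_mod_eq_0)
  then obtain k where k: "n = 5 * k"
    by (elim dvdE)
  have "t = 5 * (5 * (t div 25) + 1)" if "t mod 25 = 5" for t :: nat
    using that by presburger
  then obtain u where u: "(\<Sum>i<5. y ^ i) = 5 * (5 * u + 1)"
    using sum_five_powers_mod_25 [OF Suc.prems(1)] by blast
  have "5 * 5 ^ v dvd 5 * ((5 * u + 1) * (\<Sum>j<k. (y ^ 5) ^ j))"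
    using Suc.prems(2) unfolding k sum_powers_mult u by (simp only: power_Suc mult.assoc)
  then have "5 ^ v dvd (5 * u + 1) * (\<Sum>j<k. (y ^ 5) ^ j)"
    by (simp only: nat_mult_dvd_cancel_disj) simp
  moreover have "coprime (5 ^ v) (5 * u + 1)"
    using prime_imp_coprime [of 5 "5 * u + 1"] by simp presburger
  ultimately have "5 ^ v dvd (\<Sum>j<k. (y ^ 5) ^ j)"
    by (simp only: coprime_dvd_mult_right_iff)
  moreover have "y ^ 5 mod 5 = 1"
    using power_mod [of y 5 5] Suc.prems(1) by simp
  ultimately have "5 ^ v dvd k"
    using Suc.IH by blast
  then show ?case
    unfolding k by simp
qed simp

lemma mod_5_eq_1_if_5_dvd_sum_powers:
  fixes p :: nat
  assumes "5 dvd (\<Sum>i\<le>2 * e. p ^ i)"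
  shows "p mod 5 = 1"
proof (rule ccontr)
  assume "p mod 5 \<noteq> 1"
  then have p: "p mod 5 \<in> {0, 2, 3, 4}"
    by auto
  \<comment> \<open>Raising e by one sends a residue s to 1 + p + p^2 * s. For p = 0, 2, 3, 4 modulo
    5 this never leaves the stated set.\<close>
  have "(\<Sum>i\<le>2 * e. p ^ i) mod 5 \<in> {1, p mod 5} - {0}"
  proof (induction e)
    case (Suc e)
    let ?s = "\<Sum>i\<le>2 * e. p ^ i"
    have "(\<Sum>i\<le>2 * Suc e. p ^ i) = 1 + p + p * (p * ?s)"
      by (simp add: sum.atMost_Suc_shift sum_distrib_left del: sum.atMost_Suc)
    also have "\<dots> mod 5 = (1 + p mod 5 + (p mod 5) * ((p mod 5) * (?s mod 5))) mod 5"
      by (intro mod_add_cong mod_mult_cong) simp_all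
    finally show ?case
      using Suc p by auto
  qed simp
  with assms show False
    by (simp add: dvd_eq_mod_eq_0)
qed

lemma multiplicity_5_sum_powers_less:
  fixes p :: nat
  assumes "0 < e"
  shows "multiplicity 5 (\<Sum>i\<le>2 * e. p ^ i) < e"
proof (cases "5 dvd (\<Sum>i\<le>2 * e. p ^ i)")
  case True
  define v where "v = multiplicity 5 (\<Sum>i\<le>2 * e. p ^ i)"
  have "5 ^ v dvd (\<Sum>i<2 * e + 1. p ^ i)"
    by (simp add: v_def multiplicity_dvd lessThan_Suc_atMost)
  then have "5 ^ v dvd 2 * e + 1"
    by (rule five_power_dvd_sum_powers [OF mod_5_eq_1_if_5_dvd_sum_powers [OF True]])
  then have "5 ^ v \<le> 2 * e + 1"
    by (rule dvd_imp_le) simp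
  \<comment> \<open>Sharp at k = 1 and false at k = 0, which the case assumption excludes; it turns
    5^v <= 2 * e + 1 into v < e.\<close>
  moreover have "2 * k + 3 \<le> 5 ^ k" if "0 < k" for k :: nat
    using that by (induction k rule: nat_induct_non_zero) auto
  moreover have "0 < v"
    using True unfolding v_def
    by (subst prime_multiplicity_gt_zero_iff) (auto simp: sum_eq_0_iff)
  ultimately have "2 * v + 3 \<le> 2 * e + 1"
    by (meson le_trans)
  then show ?thesis
    by (simp add: v_def)
qed (use assms in \<open>simp add: not_dvd_imp_multiplicity_0\<close>)

section \<open>The divisor sum and prime factorisations\<close>

text \<open>Makes d -> (gcd d a, gcd d b) the inverse of multiplying divisor pairs in
  \<open>sigma_mult_coprime\<close>.\<close>

lemma gcd_mult_dvd_left: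
  fixes a b x y :: nat
  assumes "coprime a b" "x dvd a" "y dvd b"
  shows "gcd (x * y) a = x"
  by (metis assms coprime_mult_right_iff dvd_mult_div_cancel gcd_mult_left_right_cancel
      gcd_nat.order_iff)

lemma sigma_mult_coprime:
  assumes "coprime a b"
  shows "sigma (a * b) = sigma a * sigma b"
proof -
  have inv: "gcd d a * gcd d b = d" if "d dvd a * b" for d
  proof -
    obtain x y where "d = x * y" "x dvd a" "y dvd b"
      using division_decomp [OF \<open>d dvd a * b\<close>] by blast
    then show ?thesis
      using gcd_mult_dvd_left [of a b x y] gcd_mult_dvd_left [of b a y x] assms
      by (simp add: coprime_commute mult.commute)
  qed
  have "sigma a * sigma b = (\<Sum>(x, y)\<in>{x. x dvd a} \<times> {y. y dvd b}. x * y)"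
    by (simp add: sigma_def sum_product sum.cartesian_product)
  also have "\<dots> = (\<Sum>d | d dvd a * b. d)"
  proof (rule sum.reindex_bij_witness [of _ "\<lambda>d. (gcd d a, gcd d b)" "\<lambda>(x, y). x * y"])
    fix z assume "z \<in> {x. x dvd a} \<times> {y. y dvd b}"
    then show "(gcd (case z of (x, y) \<Rightarrow> x * y) a, gcd (case z of (x, y) \<Rightarrow> x * y) b) = z"
      using gcd_mult_dvd_left [of a b "fst z" "snd z"]
        gcd_mult_dvd_left [of b a "snd z" "fst z"] assms
      by (auto simp: coprime_commute mult.commute)
  qed (use inv in \<open>auto intro: mult_dvd_mono\<close>)
  finally show ?thesis
    by (simp add: sigma_def)
qed

lemma sigma_prime_power:
  assumes "prime p"
  shows "sigma (p ^ k) = (\<Sum>i\<le>k. p ^ i)"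
proof -
  have "{d. d dvd p ^ k} = (\<lambda>i. p ^ i) ` {..k}"
    using divides_primepow_nat [OF assms] by auto
  moreover have "inj_on (\<lambda>i. p ^ i) {..k}"
    using prime_gt_1_nat [OF assms] by (auto intro!: inj_onI)
  ultimately show ?thesis
    by (simp add: sigma_def sum.reindex)
qed

lemma sigma_prod_prime_powers:
  assumes "finite S" "\<And>p. p \<in> S \<Longrightarrow> prime p"
  shows "sigma (\<Prod>p\<in>S. p ^ f p) = (\<Prod>p\<in>S. \<Sum>i\<le>f p. p ^ i)"
  using assms
proof (induction S rule: finite_induct)
  case empty
  then show ?case
    by (simp add: sigma_def)
next
  case (insert q S)
  have "coprime (q ^ f q) (\<Prod>p\<in>S. p ^ f p)"
    using insert by (intro prod_coprime_right) (auto intro!: primes_coprime)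
  then show ?case
    using insert by (simp add: sigma_mult_coprime sigma_prime_power)
qed

text \<open>Multiplication by k maps divisors of n injectively to divisors of k * n, so abundancy
  never drops on passing to a multiple.\<close>

lemma mult_sigma_le:
  assumes "0 < k" "0 < n"
  shows "k * sigma n \<le> sigma (k * n)"
proof -
  have "k * sigma n = \<Sum>((*) k ` {d. d dvd n})"
    using assms by (simp add: sigma_def sum_distrib_left sum.reindex inj_on_mult)
  also have "\<dots> \<le> sigma (k * n)"
    unfolding sigma_def using assms by (intro sum_mono2) auto
  finally show ?thesis .
qed

section \<open>Friends of 20\<close>

lemma friend_of_20_sigma:
  assumes "friend_of_20 N"
  shows "10 * sigma N = 21 * N"
proof -
  have "0 < N" "real (sigma N) / real N = 21 / 10"
    using assms by (auto simp: friend_of_20_def abundancy_index_20 simp flip: abundancy_index_def)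
  then have "real (10 * sigma N) = real (21 * N)"
    by (simp add: field_simps)
  then show ?thesis
    by (simp only: of_nat_eq_iff)
qed

text \<open>Six divisors of 200 already sum to 435, and 435/200 = 2.175 exceeds 21/10; multiples
  inherit this.\<close>

lemma not_200_dvd_friend_of_20:
  assumes "friend_of_20 N"
  shows "\<not> 200 dvd N"
proof
  assume "200 dvd N"
  then obtain k where k: "N = k * 200"
    by (metis dvd_def mult.commute)
  then have "0 < k"
    using assms by (auto simp: friend_of_20_def)
  have "435 = \<Sum>{20, 25, 40, 50, 100, 200 :: nat}"
    by simp
  also have "\<dots> \<le> sigma 200"
    unfolding sigma_def by (intro sum_mono2) auto
  finally have "k * 435 \<le> sigma N"
    using mult_sigma_le [of k 200] \<open>0 < k\<close> unfolding k
    by (meson le_trans mult_le_mono2 zero_less_numeral)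
  then show False
    using friend_of_20_sigma [OF assms] k \<open>0 < k\<close> by simp
qed

lemma big_Omega_eq_sum: "big_Omega n = (\<Sum>p\<in>prime_factors n. multiplicity p n)"
  unfolding big_Omega_def size_multiset_overloaded_eq
  by (intro sum.cong) (auto simp: count_prime_factorization)

theorem corollary3:
  fixes N a m :: nat and K :: int
  assumes "a > 0" and "m > 0"
    and "N = 2 * 5 ^ (2 * a) * m ^ 2"
    and "friend_of_20 N"
    and "int (big_Omega m) \<le> K"
  shows "real N < 10 * 6 powr ((2 powi (K - 2 * int a + 3) - 1) ^ 2)"
proof -
  define M where "M = 5 ^ a * m"
  define F where "F = prime_factors M"
  define e where "e p = multiplicity p M" for p
  define s where "s p = (\<Sum>i\<le>2 * e p. p ^ i)" for p
  have N: "N = 2 * M\<^sup>2"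
    using assms(3) by (simp add: M_def power_mult_distrib power_mult mult.commute)
  have "M > 0" "5 dvd M"
    using assms(1,2) by (simp_all add: M_def)
  have "odd M"
  proof
    assume "even M"
    with \<open>5 dvd M\<close> have "2 * 5 dvd M"
      by (intro divides_mult) simp_all
    then have "2 * 10\<^sup>2 dvd N"
      unfolding N by (intro mult_dvd_mono dvd_power_same) simp_all
    with not_200_dvd_friend_of_20 [OF assms(4)] show False
      by simp
  qed
  have F: "prime p" "odd p" "0 < e p" if "p \<in> F" for p
  proof -
    show "prime p"
      using that by (auto simp: F_def)
    show "odd p"
      using that \<open>odd M\<close> dvd_trans [of 2 p M] by (auto simp: F_def in_prime_factors_iff)
    show "0 < e p"
      using that \<open>M > 0\<close> by (auto simp: F_def e_def prime_factors_multiplicity)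
  qed
  have "finite F"
    by (simp add: F_def)
  have "5 \<in> F"
    using \<open>M > 0\<close> \<open>5 dvd M\<close> by (simp add: F_def in_prime_factors_iff)
  have M2: "(\<Prod>p\<in>F. p ^ (2 * e p)) = M\<^sup>2"
  proof -
    have "(\<Prod>p\<in>F. p ^ e p) = M"
      using prime_factorization_nat [OF \<open>M > 0\<close>] by (simp add: F_def e_def)
    then show ?thesis
      by (simp add: mult.commute [of 2] power_mult prod_power_distrib [symmetric])
  qed
  have sigma_M2: "sigma (M\<^sup>2) = (\<Prod>p\<in>F. s p)"
    using sigma_prod_prime_powers [OF \<open>finite F\<close>, of "\<lambda>p. 2 * e p"] F(1)
    by (simp add: M2 s_def)
  have "sigma 2 = 3"
    using sigma_prime_power [of 2 1] by simp
  then have "sigma N = 3 * sigma (M\<^sup>2)"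
    unfolding N using \<open>odd M\<close> by (subst sigma_mult_coprime) simp_all
  then have eq: "5 * (\<Prod>p\<in>F. s p) = 7 * M\<^sup>2"
    using friend_of_20_sigma [OF assms(4)] by (simp add: sigma_M2 N)
  \<comment> \<open>Here d = 5 and n = 7, so the base 6 is d + 1.\<close>
  have "7 * (\<Prod>p\<in>F. p ^ (2 * e p)) < (5 + 1) ^ (4 ^ card F)"
  proof (rule heath_brown_nielsen_bound [OF \<open>finite F\<close>])
    show "1 < p \<and> odd p \<and> 0 < 2 * e p \<and> even (2 * e p)" if "p \<in> F" for p
      using F [OF that] prime_gt_1_nat by simp
    show "5 * (\<Prod>p\<in>F. \<Sum>i\<le>2 * e p. p ^ i) = 7 * (\<Prod>p\<in>F. p ^ (2 * e p))"
      using eq by (simp add: s_def M2)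
  qed simp_all
  then have N_less: "N < 6 ^ (4 ^ card F)"
    unfolding M2 N by simp

  \<comment> \<open>The exponents of 5 on both sides of \<open>eq\<close> are compared; the prime 5
    contributes nothing to the product, as \<open>s 5\<close> is 1 modulo 5.\<close>
  have "0 < s p" for p
    unfolding s_def by (rule sum_pos2 [of _ 0]) auto
  then have "multiplicity 5 (5 * (\<Prod>p\<in>F. s p)) = 1 + (\<Sum>p\<in>F. multiplicity 5 (s p))"
    using \<open>finite F\<close>
    by (subst prime_elem_multiplicity_mult_distrib)
      (auto simp: prime_elem_multiplicity_prod_distrib image_iff)
  moreover have "multiplicity 5 (7 * M\<^sup>2) = 2 * e 5"
    using \<open>M > 0\<close> by (simp add: prime_elem_multiplicity_mult_distrib
        prime_elem_multiplicity_power_distrib not_dvd_imp_multiplicity_0 e_def)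
  moreover have "multiplicity 5 (s 5) = 0"
    using mod_5_eq_1_if_5_dvd_sum_powers [of 5 "e 5"]
    by (intro not_dvd_imp_multiplicity_0) (auto simp: s_def)
  ultimately have v: "1 + (\<Sum>p\<in>F - {5}. multiplicity 5 (s p)) = 2 * e 5"
    using \<open>finite F\<close> \<open>5 \<in> F\<close> eq by (simp add: sum.remove)
  have "(\<Sum>p\<in>F - {5}. multiplicity 5 (s p) + 1) \<le> (\<Sum>p\<in>F - {5}. e p)"
  proof (rule sum_mono)
    fix p assume "p \<in> F - {5}"
    then show "multiplicity 5 (s p) + 1 \<le> e p"
      using multiplicity_5_sum_powers_less [of "e p" p] F(3) [of p] by (simp add: s_def)
  qed
  then have "(\<Sum>p\<in>F - {5}. multiplicity 5 (s p)) + card (F - {5}) \<le> (\<Sum>p\<in>F - {5}. e p)"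
    by (simp only: sum.distrib) simp
  moreover have "big_Omega M = e 5 + (\<Sum>p\<in>F - {5}. e p)"
    using \<open>finite F\<close> \<open>5 \<in> F\<close> by (simp add: big_Omega_eq_sum F_def e_def sum.remove)
  moreover have "big_Omega M = a + big_Omega m"
    using assms(2) by (simp add: big_Omega_def M_def prime_factorization_mult
        prime_factorization_prime_power)
  moreover have "a \<le> e 5"
    using assms(2) by (simp add: e_def M_def prime_elem_multiplicity_mult_distrib
        prime_elem_multiplicity_power_distrib)
  moreover have "card F = card (F - {5}) + 1"
    using card.remove [OF \<open>finite F\<close> \<open>5 \<in> F\<close>] by simp
  \<comment> \<open>Counting prime factors of \<open>M\<close> gives a + \<open>big_Omega m\<close>
    >= e 5 + (2 * e 5 - 1) + (card F - 1), and e 5 >= a.\<close>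
  ultimately have "card F + 2 * a \<le> big_Omega m + 2"
    using v by linarith
  then have "int (card F + 1) \<le> K - 2 * int a + 3"
    using assms(5) by linarith
  then have "(2 :: real) powi int (card F + 1) \<le> 2 powi (K - 2 * int a + 3)"
    by (intro power_int_increasing) simp_all
  then have "2 * 2 ^ card F \<le> (2 :: real) powi (K - 2 * int a + 3)"
    by (simp only: power_int_of_nat) simp
  \<comment> \<open>Since 2 * x - 1 >= x for x >= 1, one spare factor 2 absorbs the - 1 in the
    exponent.\<close>
  moreover have "(1 :: real) \<le> 2 ^ card F"
    by simp
  ultimately have "2 ^ card F \<le> (2 :: real) powi (K - 2 * int a + 3) - 1"
    by linarith
  then have "(2 ^ card F)\<^sup>2 \<le> ((2 :: real) powi (K - 2 * int a + 3) - 1)\<^sup>2"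
    by (intro power_mono) simp_all
  then have exponent: "4 ^ card F \<le> ((2 :: real) powi (K - 2 * int a + 3) - 1)\<^sup>2"
    by (simp add: power_mult [symmetric] mult.commute [of _ 2]) (simp add: power_mult)
  have "real N < real (6 ^ (4 ^ card F))"
    using N_less by (simp only: of_nat_less_iff)
  also have "\<dots> = 6 powr (4 ^ card F)"
    using powr_realpow [of "6 :: real" "4 ^ card F"] by simp
  also have "\<dots> \<le> 6 powr (((2 :: real) powi (K - 2 * int a + 3) - 1)\<^sup>2)"
    using exponent by (intro powr_mono) simp_all
  also have "\<dots> \<le> 10 * 6 powr (((2 :: real) powi (K - 2 * int a + 3) - 1)\<^sup>2)"
    by simp
  finally show ?thesis .
qed

end
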